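(* Let $b\ge 2$ be an integer. There exist constants $A,\lambda>0$ such that $$\left|m_n(x)-\frac{\log\frac{bx}{x+b-1}}{\log\frac{2b}{b+1}}\right|<Ae^{-\lambda\sqrt n}$$ for all integers $n\ge 0$ and all $x\in(1,2)$.
   Context: Fix an integer base $b\ge 2$. For real $\alpha\ge 1$, the type III base $b$ continued logarithm for $\alpha$ is defined by the recursion $y_0=\alpha$, and for $n\ge 0$: $a_n=\lfloor \log_b y_n\rfloor$, $c_n=\lfloor y_n/b^{a_n}\rfloor$; if $y_n=c_nb^{a_n}$ the process terminates; otherwise $y_{n+1}=\dfrac{b^{a_n}}{y_n-c_nb^{a_n}}$. (Thus $a_n\in\mathbb{Z}_{\ge 0}$, $c_n\in\{1,\dots,b-1\}$.) The process is infinite for irrational $\alpha$; the sets below are considered up to the null set of rational $\alpha$. For $\alpha\in(1,2)$ (so $a_0=0$, $c_0=1$) put $r_n(\alpha)=y_n$ and $$z_n(\alpha)=\frac{r_n(\alpha)}{b^{a_n}}-c_n+1\in(1,2).$$ Define $M_n(x)=\{\alpha\in(1,2): z_n(\alpha)<x\}$ and let $m_n(x)$ be the Lebesgue measure of $M_n(x)$. *)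

theory Defs
  imports "HOL-Analysis.Analysis"
begin

text \<open>
  Type III continued logarithms to an integer base \<open>b\<close>. From a current remainder \<open>y \<ge> 1\<close>,
  one step extracts the exponent \<open>a\<close> and the coefficient \<open>c\<close>.
\<close>

definition clog_exponent :: "nat \<Rightarrow> real \<Rightarrow> int" where
  "clog_exponent b y = \<lfloor>log (real b) y\<rfloor>"

definition clog_coeff :: "nat \<Rightarrow> real \<Rightarrow> int" where
  "clog_coeff b y = \<lfloor>y / real b powi clog_exponent b y\<rfloor>"

text \<open>
  The sequence of remainders \<open>y\<^sub>0 = \<alpha>, y\<^sub>1, y\<^sub>2, \<dots>\<close>. If the process terminates at \<open>y\<^sub>n\<close>,
  the denominator below is 0 and the later values are meaningless. This happens only for
  rational \<open>\<alpha>\<close>, and those are excluded in \<open>clog_M\<close>.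
\<close>

primrec clog_y :: "nat \<Rightarrow> real \<Rightarrow> nat \<Rightarrow> real" where
  "clog_y b \<alpha> 0 = \<alpha>"
| "clog_y b \<alpha> (Suc n) =
     real b powi clog_exponent b (clog_y b \<alpha> n) /
     (clog_y b \<alpha> n -
      of_int (clog_coeff b (clog_y b \<alpha> n)) * real b powi clog_exponent b (clog_y b \<alpha> n))"

definition clog_a :: "nat \<Rightarrow> real \<Rightarrow> nat \<Rightarrow> int" where
  "clog_a b \<alpha> n = clog_exponent b (clog_y b \<alpha> n)"

definition clog_c :: "nat \<Rightarrow> real \<Rightarrow> nat \<Rightarrow> int" where
  "clog_c b \<alpha> n = clog_coeff b (clog_y b \<alpha> n)"

definition clog_z :: "nat \<Rightarrow> nat \<Rightarrow> real \<Rightarrow> real" where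
  "clog_z b n \<alpha> = clog_y b \<alpha> n / real b powi clog_a b \<alpha> n - of_int (clog_c b \<alpha> n) + 1"

text \<open>
  Removing the rationals changes the set only by a null set and ensures that \<open>clog_z b n \<alpha>\<close>
  is given by the non-terminating process.
\<close>

definition clog_M :: "nat \<Rightarrow> nat \<Rightarrow> real \<Rightarrow> real set" where
  "clog_M b n x = {\<alpha> \<in> {1<..<2} - \<rat>. clog_z b n \<alpha> < x}"

definition clog_m :: "nat \<Rightarrow> nat \<Rightarrow> real \<Rightarrow> real" where
  "clog_m b n x = measure lebesgue (clog_M b n x)"

end

theory Submission
  imports Defs
begin

text \<open>
  With \<open>t = z - 1\<close> the process is the iteration of a map of \<open>(0, 1)\<close> with inverse branches
  \<open>u \<mapsto> 1 / (b\<^sup>a (c + u))\<close>. Under Lebesgue measure conditioned on the first \<open>n\<close> digits, \<open>t\<^sub>n < x\<close> has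
  probability \<open>\<phi>\<^sub>x(\<theta>) = x (1 + \<theta>) / (1 + \<theta> x)\<close> for some \<open>\<theta> \<in> [0, 1]\<close>, and conditioning on further digits
  \<open>(a, c)\<close> replaces \<open>\<theta>\<close> by \<open>1 / (c + \<theta> b\<^sup>-\<^sup>a)\<close> with an explicit probability. Hence \<open>m\<^sub>n(1 + x)\<close> is the value at
  \<open>\<theta> = 0\<close> of the \<open>n\<close>-th iterate, applied to \<open>\<phi>\<^sub>x\<close>, of the Markov operator of this dual chain.

  This operator shrinks Lipschitz constants by the factor \<open>11/12\<close>, and it preserves the integral against
  \<open>d\<theta> / (1 + \<theta>)\<close> over \<open>[1/b, 1]\<close>, because these integrals telescope over the digits. So the iterates
  converge to the normalised integral of \<open>\<phi>\<^sub>x\<close>, which is the logarithmic limit law. The error is at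
  most \<open>(11/12)\<^sup>n\<close>, which is stronger than the claim.
\<close>

subsection \<open>The dual Markov chain\<close>

locale clog_base =
  fixes b :: nat
  assumes b2: "2 \<le> b"
begin

text \<open>Probability of the interval from \<open>1 / (b^a (c + 1))\<close> to
  \<open>1 / (b^a c)\<close>, the points with digits \<open>(a, c)\<close>, under the distribution
  function \<open>(1 + \<theta>) t / (1 + \<theta> t)\<close> of t in (0, 1).\<close>

definition weight :: "nat \<Rightarrow> nat \<Rightarrow> real \<Rightarrow> real" where
  "weight a c \<theta> = (1 + \<theta>) * real b ^ a / ((real b ^ a * c + \<theta>) * (real b ^ a * (c + 1) + \<theta>))"

definition dual :: "nat \<Rightarrow> nat \<Rightarrow> real \<Rightarrow> real" where
  "dual a c \<theta> = real b ^ a / (real b ^ a * c + \<theta>)"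

text \<open>The outer sum is a \<open>suminf\<close>, meaningful only for a convergent series;
  \<open>dual_op_sums\<close> supplies convergence when \<open>\<phi>\<close> is bounded on
  [0, 1].\<close>

definition dual_op :: "(real \<Rightarrow> real) \<Rightarrow> real \<Rightarrow> real" where
  "dual_op \<phi> \<theta> = (\<Sum>a. \<Sum>c=1..<b. weight a c \<theta> * \<phi> (dual a c \<theta>))"

lemma pow_ge_1: "1 \<le> real b ^ a"
  using b2 by (intro one_le_power) simp

lemma pow_ge_base: "a \<noteq> 0 \<Longrightarrow> real b \<le> real b ^ a"
  using b2 by (intro self_le_power) auto

lemma denom_bounds:
  assumes "1 \<le> c" "c < b" "0 \<le> \<theta>"
  shows "1 \<le> real b ^ a * c" "1 \<le> real b ^ a * c + \<theta>" "1 \<le> real b ^ a * (real c + 1) + \<theta>"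
proof -
  show *: "1 \<le> real b ^ a * c"
    using mult_mono[OF pow_ge_1[of a], of 1 "real c"] assms by simp
  then show "1 \<le> real b ^ a * c + \<theta>" using assms by simp
  then show "1 \<le> real b ^ a * (real c + 1) + \<theta>" using pow_ge_1[of a] by (simp add: algebra_simps)
qed

lemma weight_nonneg:
  assumes "1 \<le> c" "c < b" "0 \<le> \<theta>"
  shows "0 \<le> weight a c \<theta>"
  using denom_bounds[OF assms, of a] pow_ge_1[of a] assms by (simp add: weight_def)

text \<open>The increment of the distribution function between the two endpoints of the digit
  interval. This form makes the sums over digits telescope.\<close>

lemma weight_eq_diff:
  assumes "1 \<le> c" "c < b" "0 \<le> \<theta>"
  shows "weight a c \<theta> = (1 + \<theta>) / (real b ^ a * c + \<theta>) - (1 + \<theta>) / (real b ^ a * (Suc c) + \<theta>)"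
proof -
  have "real b ^ a * c + \<theta> \<noteq> 0" "real b ^ a * (real c + 1) + \<theta> \<noteq> 0"
    using denom_bounds[OF assms, of a] by linarith+
  then show ?thesis
    by (simp add: weight_def diff_frac_eq add.commute[of 1 "real c"]) (simp add: algebra_simps)
qed

text \<open>Telescoping in c; the last endpoint \<open>b^a * b\<close> is the first endpoint of
  level \<open>Suc a\<close>, so the sum over a will telescope in turn.\<close>

lemma sum_weight:
  assumes "0 \<le> \<theta>"
  shows "(\<Sum>c=1..<b. weight a c \<theta>) = (1 + \<theta>) / (real b ^ a + \<theta>) - (1 + \<theta>) / (real b ^ Suc a + \<theta>)"
proof -
  have "(\<Sum>c=1..<b. weight a c \<theta>) =
      - (\<Sum>c=1..<b. (1 + \<theta>) / (real b ^ a * (Suc c) + \<theta>) - (1 + \<theta>) / (real b ^ a * c + \<theta>))"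
    unfolding sum_negf[symmetric] using assms by (intro sum.cong) (auto simp: weight_eq_diff)
  also have "\<dots> = (1 + \<theta>) / (real b ^ a + \<theta>) - (1 + \<theta>) / (real b ^ Suc a + \<theta>)"
    using b2 by (subst sum_Suc_diff') (auto simp: mult.commute)
  finally show ?thesis .
qed

lemma power_tendsto_at_top: "filterlim (\<lambda>n. real b ^ n) at_top sequentially"
  using b2 by (intro filterlim_at_infinity_imp_filterlim_at_top[OF filterlim_realpow_sequentially_gt1]) auto

lemma weight_sums:
  assumes "0 \<le> \<theta>"
  shows "(\<lambda>a. \<Sum>c=1..<b. weight a c \<theta>) sums 1"
proof -
  have "(\<lambda>a. (1 + \<theta>) / (real b ^ a + \<theta>)) \<longlonglongrightarrow> 0"
    using filterlim_tendsto_add_at_top[OF tendsto_const power_tendsto_at_top, of \<theta>]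
    by (intro real_tendsto_divide_at_top[OF tendsto_const]) (simp add: add.commute)
  then show ?thesis
    unfolding sum_weight[OF assms]
    using telescope_sums'[of "\<lambda>a. (1 + \<theta>) / (real b ^ a + \<theta>)" 0] assms by simp
qed

lemma dual_bounds:
  assumes "1 \<le> c" "c < b" "0 \<le> \<theta>" "\<theta> \<le> 1"
  shows "1 / b \<le> dual a c \<theta>" "dual a c \<theta> \<le> 1" "0 \<le> dual a c \<theta>"
proof -
  have "real b ^ a * c + \<theta> \<le> real b ^ a * c + real b ^ a * 1"
    using order_trans[OF \<open>\<theta> \<le> 1\<close> pow_ge_1[of a]] by simp
  also have "\<dots> = real b ^ a * real (c + 1)" by (simp add: algebra_simps)
  also have "\<dots> \<le> real b ^ a * b"
    using assms by (intro mult_left_mono) auto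
  finally show "1 / b \<le> dual a c \<theta>"
    using denom_bounds[OF assms(1-3), of a] b2 by (simp add: dual_def field_simps)
  have "real b ^ a * 1 \<le> real b ^ a * c"
    using assms by (intro mult_left_mono) auto
  then have "real b ^ a \<le> real b ^ a * c + \<theta>" using assms by linarith
  then show "dual a c \<theta> \<le> 1" "0 \<le> dual a c \<theta>"
    unfolding dual_def using denom_bounds(2)[OF assms(1-3), of a] by simp_all
qed

text \<open>The interval [1/b, 1] can therefore carry the invariant measure, although the chain
  starts at 0, outside it.\<close>

lemma dual_in_range:
  assumes "1 \<le> c" "c < b" "\<theta> \<in> {1 / b..1}"
  shows "dual a c \<theta> \<in> {1 / b..1}"
proof -
  have "0 \<le> 1 / real b" by simp
  then show ?thesis using dual_bounds[of c \<theta> a] assms unfolding atLeastAtMost_iff by linarith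
qed

text \<open>The factor \<open>b^a / (b^a c + \<theta>)\<^sup>2\<close> is minus the derivative of
  \<open>dual a c\<close>. The identity serves twice: as the substitution rule for the invariant
  integral, and to match the scaling of Lebesgue measure on a branch.\<close>

lemma weight_mult_dual:
  assumes "1 \<le> c" "c < b" "0 \<le> \<theta>"
  shows "weight a c \<theta> * (1 + dual a c \<theta>) = (1 + \<theta>) * (real b ^ a / (real b ^ a * c + \<theta>)\<^sup>2)"
proof -
  define B where "B = real b ^ a"
  define q where "q = B * c + \<theta>"
  have q: "1 \<le> q" "1 \<le> q + B"
    using denom_bounds[OF assms, of a] pow_ge_1[of a] by (auto simp: q_def B_def)
  have "weight a c \<theta> = (1 + \<theta>) * B / (q * (q + B))"
    by (simp add: weight_def q_def B_def algebra_simps)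
  moreover have "dual a c \<theta> = B / q" by (simp add: dual_def q_def B_def)
  then have "1 + dual a c \<theta> = (q + B) / q" using q by (simp add: field_simps)
  ultimately have "weight a c \<theta> * (1 + dual a c \<theta>) = (1 + \<theta>) * (B / q\<^sup>2)"
    using q by (simp add: power2_eq_square)
  then show ?thesis by (simp add: B_def q_def)
qed

lemma summable_weight:
  assumes "0 \<le> \<theta>" "\<And>a c. 1 \<le> c \<Longrightarrow> c < b \<Longrightarrow> \<bar>f a c\<bar> \<le> K"
  shows "summable (\<lambda>a. \<Sum>c=1..<b. weight a c \<theta> * f a c)"
proof (rule summable_comparison_test')
  show "summable (\<lambda>a. (\<Sum>c=1..<b. weight a c \<theta>) * K)"
    using weight_sums[OF assms(1)] by (intro summable_mult2) (rule sums_summable)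
  show "norm (\<Sum>c=1..<b. weight a c \<theta> * f a c) \<le> (\<Sum>c=1..<b. weight a c \<theta>) * K" if "0 \<le> a" for a
    unfolding sum_distrib_right
    using assms by (intro sum_norm_le) (auto simp: abs_mult weight_nonneg intro!: mult_left_mono)
qed

text \<open>With \<open>y = b\<^sup>a c\<close> and \<open>z = b\<^sup>a (c + 1)\<close>, the numerator of \<open>weight a c s - weight a c t\<close> is
  a positive multiple of \<open>(1 + s) (1 + t) - (y - 1) (z - 1)\<close>; only \<open>(a, c) = (0, 1)\<close> has \<open>y < 2\<close>.\<close>

lemma weight_lower:
  assumes "1 \<le> c" "c < b" "(a, c) \<noteq> (0, 1)" "0 \<le> s" "s \<le> t" "t \<le> 1"
  shows "weight a c s - weight a c t \<le> weight a c s * (t - s) / 12"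
proof -
  define B where "B = real b ^ a"
  define y z where "y = B * c" and "z = B * (real c + 1)"
  have B: "1 \<le> B" unfolding B_def by (rule pow_ge_1)
  have y: "2 \<le> y"
  proof (cases "a = 0")
    case True
    then show ?thesis using assms by (auto simp: y_def B_def)
  next
    case False
    then have "2 \<le> B" unfolding B_def using pow_ge_base[of a] b2 by linarith
    then show ?thesis using mult_mono[of 2 B 1 "real c"] assms by (simp add: y_def)
  qed
  have z: "3 \<le> z" using y B by (simp add: y_def z_def algebra_simps)
  have 1: "2 \<le> (y - 1) * (z - 1)" using mult_mono[of 1 "y - 1" 2 "z - 1"] y z by simp
  have "(1 + s) * (1 + t) - (y - 1) * (z - 1) \<le> (1 + s) * t"
    using 1 assms by (simp add: algebra_simps)
  also have "\<dots> \<le> (1 + s) * ((y + t) * (z + t) / 12)"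
  proof (intro mult_left_mono)
    have "(2 + t) * (3 + t) \<le> (y + t) * (z + t)"
      using y z assms by (intro mult_mono) auto
    \<comment> \<open>Expanded, this says \<open>12 t \<le> (2 + t) (3 + t)\<close>, with equality
      at t = 1; hence the constant 12.\<close>
    moreover have "0 \<le> (1 - t) * (6 - t)" using assms by simp
    ultimately show "t \<le> (y + t) * (z + t) / 12" by (simp add: algebra_simps)
  qed (use assms in auto)
  finally have 2: "(1 + s) * (1 + t) - (y - 1) * (z - 1) \<le> (1 + s) * (y + t) * (z + t) / 12" by simp
  have pos: "0 < y + s" "0 < z + s" "0 < y + t" "0 < z + t" using y z assms by auto
  have w: "weight a c x = (1 + x) * B / ((y + x) * (z + x))" for x
    by (simp add: weight_def B_def y_def z_def)
  have "weight a c s - weight a c t =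
      (t - s) * B * ((1 + s) * (1 + t) - (y - 1) * (z - 1)) / ((y + s) * (z + s) * (y + t) * (z + t))"
  proof -
    have "(y + s) * (z + s) \<noteq> 0" "(y + t) * (z + t) \<noteq> 0" using pos by auto
    note diff = diff_frac_eq[OF this]
    have "(1 + s) * B * ((y + t) * (z + t)) - (1 + t) * B * ((y + s) * (z + s)) =
        (t - s) * B * ((1 + s) * (1 + t) - (y - 1) * (z - 1))"
      by (simp add: algebra_simps)
    then show ?thesis unfolding w diff by (simp only: mult.assoc)
  qed
  also have "\<dots> \<le> (t - s) * B * ((1 + s) * (y + t) * (z + t) / 12) / ((y + s) * (z + s) * (y + t) * (z + t))"
    using 2 pos assms B by (intro divide_right_mono mult_left_mono) auto
  also have "\<dots> = weight a c s * (t - s) / 12"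
    unfolding w using pos by (simp add: divide_simps)
  finally show ?thesis .
qed

lemma weight_0_1: "0 \<le> \<theta> \<Longrightarrow> weight 0 1 \<theta> = 1 / (2 + \<theta>)"
  by (simp add: weight_def divide_simps)

text \<open>Covers the digit pair excluded from \<open>weight_lower\<close>. The relative decrease
  is exactly \<open>(t - s) / (2 + t)\<close>, so the constant is 1/2 instead of 1/12.\<close>

lemma weight_0_1_diff:
  assumes "0 \<le> s" "s \<le> t"
  shows "weight 0 1 s - weight 0 1 t \<le> weight 0 1 s * (t - s) / 2"
proof -
  have "weight 0 1 s - weight 0 1 t = weight 0 1 s * (t - s) / (2 + t)"
    unfolding weight_0_1[OF assms(1)] weight_0_1[OF order_trans[OF assms]]
    using assms by (simp add: field_simps)
  also have "\<dots> \<le> weight 0 1 s * (t - s) / 2"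
    using assms by (intro divide_left_mono mult_nonneg_nonneg) (auto simp: weight_def)
  finally show ?thesis .
qed

text \<open>The difference quotient is at most \<open>1 / (b^a c\<^sup>2)\<close> in absolute value.
  This is at most 1/b if a > 0 and at most 1/4 if a = 0 and c > 1; only \<open>(0, 1)\<close> gives
  no contraction.\<close>

lemma dual_diff:
  assumes "1 \<le> c" "c < b" "0 \<le> s" "s \<le> t"
  shows "\<bar>dual a c s - dual a c t\<bar> \<le> (if (a, c) = (0, 1) then 1 else max (1 / b) (1 / 4)) * (t - s)"
proof -
  define B where "B = real b ^ a"
  define y where "y = B * real c"
  have B: "1 \<le> B" unfolding B_def by (rule pow_ge_1)
  have y: "1 \<le> y" unfolding y_def B_def by (rule denom_bounds[OF assms(1-3)])
  have c: "1 \<le> c * c" "2 \<le> c \<Longrightarrow> 4 \<le> c * c"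
    using assms mult_le_mono[of 1 c 1 c] mult_le_mono[of 2 c 2 c] by auto
  have "\<bar>dual a c s - dual a c t\<bar> = \<bar>B * (t - s) / ((y + s) * (y + t))\<bar>"
    using y assms by (simp add: dual_def B_def[symmetric] y_def[symmetric] divide_simps) (simp add: algebra_simps)
  also have "\<dots> = B * (t - s) / ((y + s) * (y + t))" using B y assms by simp
  also have "\<dots> \<le> B * (t - s) / (y * y)"
    using y B assms by (intro divide_left_mono mult_mono) auto
  also have "\<dots> = (1 / (B * real (c * c))) * (t - s)"
    using B by (simp add: y_def)
  also have "\<dots> \<le> (if (a, c) = (0, 1) then 1 else max (1 / b) (1 / 4)) * (t - s)"
  proof (intro mult_right_mono)
    consider "(a, c) = (0, 1)" | "a \<noteq> 0" | "a = 0" "2 \<le> c" using assms by fastforce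
    then show "1 / (B * real (c * c)) \<le> (if (a, c) = (0, 1) then 1 else max (1 / b) (1 / 4))"
    proof cases
      case 1 then show ?thesis by (simp add: B_def)
    next
      case 2
      then have "real b * 1 \<le> B * real (c * c)"
        using pow_ge_base[of a] c unfolding B_def of_nat_le_iff[symmetric, where 'a=real]
        by (intro mult_mono) auto
      then have "1 / (B * real (c * c)) \<le> 1 / b"
        using b2 by (intro divide_left_mono) auto
      then show ?thesis using 2 by simp
    next
      case 3
      then have "4 \<le> real (c * c)" using c by (metis of_nat_le_iff of_nat_numeral)
      then have "1 / (B * real (c * c)) \<le> 1 / 4" using 3 by (intro divide_left_mono) (auto simp: B_def)
      then show ?thesis using 3 by simp
    qed
  qed (use assms in auto)
  finally show ?thesis .
qed

lemma lipschitz_on_unit_bounded: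
  fixes \<phi> :: "real \<Rightarrow> real"
  assumes "D-lipschitz_on {0..1} \<phi>" "0 \<le> x" "x \<le> 1"
  shows "\<bar>\<phi> x\<bar> \<le> \<bar>\<phi> 0\<bar> + D"
  using lipschitz_onD[OF assms(1), of x 0] assms(2,3)
    mult_left_mono[of x 1 D] lipschitz_on_nonneg[OF assms(1)] by (auto simp: dist_real_def)

subsection \<open>Contraction of Lipschitz constants\<close>

lemma dual_op_sums:
  assumes "\<And>x. 0 \<le> x \<Longrightarrow> x \<le> 1 \<Longrightarrow> \<bar>\<phi> x\<bar> \<le> K" "0 \<le> \<theta>" "\<theta> \<le> 1"
  shows "(\<lambda>a. \<Sum>c=1..<b. weight a c \<theta> * \<phi> (dual a c \<theta>)) sums dual_op \<phi> \<theta>"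
  unfolding dual_op_def using assms
  by (intro summable_sums summable_weight[of _ _ K]) (auto intro!: assms(1) dual_bounds)

text \<open>Subtracting a constant \<open>m\<close> leaves the difference unchanged, since the weights sum to 1, and makes
  the test function nonnegative with maximum at most \<open>osc\<close> on \<open>[1/b, 1]\<close>. Hence only the decrease
  of the weights from \<open>s\<close> to \<open>t\<close> costs anything, and this is small by \<open>weight_lower\<close>.\<close>

lemma dual_op_diff_le:
  assumes lip: "D-lipschitz_on {0..1} \<phi>"
    and st: "0 \<le> s" "s \<le> t" "t \<le> 1"
  shows "dual_op \<phi> s - dual_op \<phi> t \<le> 11 / 12 * D * (t - s)"
proof -
  have D: "0 \<le> D" using lip by (rule lipschitz_on_nonneg)
  have lipD: "\<bar>\<phi> x - \<phi> y\<bar> \<le> D * \<bar>x - y\<bar>" if "x \<in> {0..1}" "y \<in> {0..1}" for x y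
    using lipschitz_onD[OF lip that] by (simp add: dist_real_def)
  define r where "r = 1 / real b"
  define \<gamma> where "\<gamma> = max r (1 / 4)"
  define osc where "osc = D * (1 - r)"
  \<comment> \<open>Every point of [r, 1] lies within \<open>(1 - r) / 2\<close> of the midpoint, so
    \<open>\<phi>\<close> deviates from its midpoint value by at most \<open>osc / 2\<close>; this
    choice of \<open>m\<close> places \<open>\<psi>\<close> between 0 and
    \<open>osc\<close>.\<close>
  define m where "m = \<phi> ((1 + r) / 2) - osc / 2"
  define \<psi> where "\<psi> x = \<phi> x - m" for x
  have r: "0 < r" "r \<le> 1 / 2" using b2 by (auto simp: r_def field_simps)
  have osc: "0 \<le> osc" unfolding osc_def using D r by simp
  have \<psi>: "0 \<le> \<psi> x \<and> \<psi> x \<le> osc" if "r \<le> x" "x \<le> 1" for x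
  proof -
    have "\<bar>\<phi> x - \<phi> ((1 + r) / 2)\<bar> \<le> D * \<bar>x - (1 + r) / 2\<bar>" using that r by (intro lipD) auto
    also have "\<dots> \<le> D * ((1 - r) / 2)" using that D by (intro mult_left_mono) (auto simp: abs_le_iff field_simps)
    also have "\<dots> = osc / 2" by (simp add: osc_def)
    finally show ?thesis unfolding \<psi>_def m_def by linarith
  qed
  define S where "S x a = (\<Sum>c=1..<b. weight a c x * \<psi> (dual a c x))" for x a
  have S: "S x sums (dual_op \<phi> x - m)" if "0 \<le> x" "x \<le> 1" for x
  proof -
    have "(\<lambda>a. (\<Sum>c=1..<b. weight a c x * \<phi> (dual a c x)) - (\<Sum>c=1..<b. weight a c x) * m) sums (dual_op \<phi> x - 1 * m)"
      using that by (intro sums_diff dual_op_sums[OF lipschitz_on_unit_bounded[OF lip]] sums_mult2 weight_sums)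
    moreover have "(\<lambda>a. (\<Sum>c=1..<b. weight a c x * \<phi> (dual a c x)) - (\<Sum>c=1..<b. weight a c x) * m) = S x"
      by (simp add: S_def \<psi>_def sum_distrib_right sum_subtractf right_diff_distrib fun_eq_iff)
    ultimately show ?thesis by simp
  qed
  \<comment> \<open>The change of a product splits into a change of \<open>\<psi>\<close> weighted
    at s and a change of weight times \<open>\<psi>\<close> at t. All pairs are charged the rates
    1/12 and \<open>\<gamma>\<close>; the pair \<open>(0, 1)\<close> has rates 1/2 and 1, and pays
    the surplus 5/12 and \<open>1 - \<gamma>\<close> separately.\<close>
  have step: "weight a c s * \<psi> (dual a c s) - weight a c t * \<psi> (dual a c t) \<le>
      (t - s) * (weight a c s * (osc / 12 + \<gamma> * D) +
        (if (a, c) = (0, 1) then weight 0 1 s * (5 / 12 * osc + (1 - \<gamma>) * D) else 0))"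
    if c: "1 \<le> c" "c < b" for a c
  proof -
    define e where "e = (if (a, c) = (0, 1) then 1 / 2 else 1 / 12 :: real)"
    define g where "g = (if (a, c) = (0, 1) then 1 else \<gamma>)"
    have w: "0 \<le> weight a c s" using c st by (intro weight_nonneg)
    have ds: "r \<le> dual a c s" "dual a c s \<le> 1" "r \<le> dual a c t" "dual a c t \<le> 1"
      unfolding r_def using c st by (auto intro!: dual_bounds)
    have "\<psi> (dual a c s) - \<psi> (dual a c t) \<le> D * \<bar>dual a c s - dual a c t\<bar>"
      using lipD[of "dual a c s" "dual a c t"] ds r by (simp add: \<psi>_def)
    also have "\<dots> \<le> D * (g * (t - s))"
      unfolding g_def \<gamma>_def r_def using c st D by (intro mult_left_mono dual_diff)
    finally have 1: "weight a c s * (\<psi> (dual a c s) - \<psi> (dual a c t)) \<le> weight a c s * (D * (g * (t - s)))"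
      using w by (rule mult_left_mono)
    have "weight a c s - weight a c t \<le> weight a c s * (t - s) * e"
      using weight_lower[of c a s t] weight_0_1_diff[of s t] c st by (auto simp: e_def)
    then have "(weight a c s - weight a c t) * \<psi> (dual a c t) \<le> weight a c s * (t - s) * e * \<psi> (dual a c t)"
      using \<psi>[of "dual a c t"] ds by (intro mult_right_mono) auto
    also have "\<dots> \<le> weight a c s * (t - s) * e * osc"
      using \<psi>[of "dual a c t"] ds w st by (intro mult_left_mono mult_nonneg_nonneg) (auto simp: e_def)
    finally have "weight a c s * \<psi> (dual a c s) - weight a c t * \<psi> (dual a c t) \<le>
        (t - s) * (weight a c s * (D * g + e * osc))"
      using 1 by (simp add: algebra_simps)
    also have "\<dots> = (t - s) * (weight a c s * (osc / 12 + \<gamma> * D) +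
        (if (a, c) = (0, 1) then weight 0 1 s * (5 / 12 * osc + (1 - \<gamma>) * D) else 0))"
      by (auto simp: e_def g_def field_simps)
    finally show ?thesis .
  qed
  define X where "X = weight 0 1 s * (5 / 12 * osc + (1 - \<gamma>) * D)"
  have "(\<lambda>a. (\<Sum>c=1..<b. weight a c s) * (osc / 12 + \<gamma> * D) + (if a = 0 then X else 0)) sums
      (1 * (osc / 12 + \<gamma> * D) + X)"
    using st sums_single[of 0 "\<lambda>_. X"] by (intro sums_add sums_mult2 weight_sums) auto
  moreover have "(if a = 0 then X else 0) = (\<Sum>c=1..<b. if (a, c) = (0, 1) then X else 0)" for a :: nat
    using b2 by (auto simp: sum.delta)
  ultimately have upper: "(\<lambda>a. (t - s) * (\<Sum>c=1..<b. weight a c s * (osc / 12 + \<gamma> * D) +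
      (if (a, c) = (0, 1) then X else 0))) sums ((t - s) * (osc / 12 + \<gamma> * D + X))"
    by (intro sums_mult) (simp add: sum.distrib sum_distrib_right)
  have termwise: "S s a - S t a \<le> (t - s) * (\<Sum>c=1..<b. weight a c s * (osc / 12 + \<gamma> * D) +
      (if (a, c) = (0, 1) then X else 0))" for a
    unfolding S_def sum_subtractf[symmetric] sum_distrib_left X_def
    by (intro sum_mono step) auto
  have "(\<lambda>a. S s a - S t a) sums ((dual_op \<phi> s - m) - (dual_op \<phi> t - m))"
    using st by (intro sums_diff S) auto
  then have le: "(dual_op \<phi> s - m) - (dual_op \<phi> t - m) \<le> (t - s) * (osc / 12 + \<gamma> * D + X)"
    using upper by (rule sums_le[OF termwise])
  \<comment> \<open>The bad pair \<open>(0, 1)\<close> has probability at most one half, so its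
    surplus enters at most half.\<close>
  have "weight 0 1 s \<le> 1 / 2" unfolding weight_0_1[OF st(1)] using st by (simp add: field_simps)
  then have "X \<le> 1 / 2 * (5 / 12 * osc + (1 - \<gamma>) * D)"
    unfolding X_def using osc r D by (intro mult_right_mono add_nonneg_nonneg mult_nonneg_nonneg) (auto simp: \<gamma>_def)
  then have "osc / 12 + \<gamma> * D + X \<le> D * ((1 - r) * (7 / 24) + (1 + \<gamma>) / 2)"
    by (simp add: osc_def field_simps)
  \<comment> \<open>For r below 1/4, \<open>\<gamma>\<close> is 1/4 and the bracket tends to 7/24 +
    5/8 = 11/12 as r tends to 0. For r between 1/4 and 1/2 it is at most 43/48.\<close>
  also have "\<dots> \<le> D * (11 / 12)"
    using r D by (intro mult_left_mono) (auto simp: \<gamma>_def max_def field_simps)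
  finally have "(t - s) * (osc / 12 + \<gamma> * D + X) \<le> (t - s) * (D * (11 / 12))"
    using st by (intro mult_left_mono) auto
  also have "\<dots> = 11 / 12 * D * (t - s)" by simp
  finally show ?thesis using le by linarith
qed

text \<open>Lets the one-sided bound \<open>dual_op_diff_le\<close> be applied to
  \<open>- \<phi>\<close> too, giving a bound on the absolute value. Boundedness makes the series
  converge, so that the sign can be taken out.\<close>

lemma dual_op_minus: "dual_op (\<lambda>x. - \<phi> x) \<theta> = - dual_op \<phi> \<theta>"
  if "\<And>x. 0 \<le> x \<Longrightarrow> x \<le> 1 \<Longrightarrow> \<bar>\<phi> x\<bar> \<le> K" "0 \<le> \<theta>" "\<theta> \<le> 1"
proof -
  have "(\<lambda>a. \<Sum>c=1..<b. weight a c \<theta> * - \<phi> (dual a c \<theta>)) sums - dual_op \<phi> \<theta>"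
    using sums_minus[OF dual_op_sums[of \<phi>, OF that]] by (simp add: sum_negf)
  then show ?thesis unfolding dual_op_def by (rule sums_unique[symmetric])
qed

lemma dual_op_lipschitz:
  assumes "D-lipschitz_on {0..1} \<phi>"
  shows "(11 / 12 * D)-lipschitz_on {0..1} (dual_op \<phi>)"
proof (rule lipschitz_onI)
  have neg: "D-lipschitz_on {0..1} (\<lambda>x. - \<phi> x)"
    using assms by (simp add: lipschitz_on_def dist_minus)
  have *: "\<bar>dual_op \<phi> s - dual_op \<phi> t\<bar> \<le> 11 / 12 * D * (t - s)" if "0 \<le> s" "s \<le> t" "t \<le> 1" for s t
    using dual_op_diff_le[OF assms that] dual_op_diff_le[OF neg that] that
    unfolding abs_le_iff by (simp add: dual_op_minus[OF lipschitz_on_unit_bounded[OF assms]])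
  show "dist (dual_op \<phi> x) (dual_op \<phi> y) \<le> 11 / 12 * D * dist x y" if "x \<in> {0..1}" "y \<in> {0..1}" for x y
  proof (cases "x \<le> y")
    case True
    then show ?thesis using *[of x y] that by (simp add: dist_real_def)
  next
    case False
    then show ?thesis using *[of y x] that by (simp add: dist_real_def abs_minus_commute)
  qed
  show "0 \<le> 11 / 12 * D" using lipschitz_on_nonneg[OF assms] by simp
qed

lemma dual_op_funpow_lipschitz:
  assumes "D-lipschitz_on {0..1} \<phi>"
  shows "((11 / 12) ^ n * D)-lipschitz_on {0..1} ((dual_op ^^ n) \<phi>)"
  using assms by (induction n) (auto dest: dual_op_lipschitz simp: mult.assoc)

subsection \<open>The invariant integral\<close>

text \<open>Substitution v = \<open>dual a c \<theta>\<close>: by \<open>weight_mult_dual\<close>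
  the integrand is \<open>f v\<close> times minus dv. The map is decreasing, and its value at 1/b is
  its value at 1 for the next exponent, so the results telescope in a.\<close>

lemma weight_dual_has_integral:
  assumes cont: "continuous_on {1 / b..1} f" and c: "1 \<le> c" "c < b"
  shows "((\<lambda>\<theta>. weight a c \<theta> * (f (dual a c \<theta>) * (1 + dual a c \<theta>)) / (1 + \<theta>)) has_integral
    integral {1 / b..dual (Suc a) c 1} f - integral {1 / b..dual a c 1} f) {1 / b..1}"
proof -
  define r where "r = 1 / real b"
  define \<Phi> where "\<Phi> x = integral {r..x} f" for x
  have r: "0 < r" "r \<le> 1" using b2 by (auto simp: r_def field_simps)
  have "((\<lambda>\<theta>. - \<Phi> (dual a c \<theta>)) has_vector_derivative
      weight a c \<theta> * (f (dual a c \<theta>) * (1 + dual a c \<theta>)) / (1 + \<theta>)) (at \<theta> within {r..1})"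
    if \<theta>: "\<theta> \<in> {r..1}" for \<theta>
  proof -
    have \<theta>0: "0 \<le> \<theta>" using \<theta> r by simp
    define B where "B = real b ^ a"
    define q where "q = B * c + \<theta>"
    have q: "1 \<le> q" unfolding q_def B_def by (rule denom_bounds[OF c \<theta>0])
    have "(dual a c has_field_derivative - (B / q\<^sup>2)) (at \<theta> within {r..1})"
      unfolding dual_def B_def[symmetric] using q
      by (auto intro!: derivative_eq_intros simp: q_def power2_eq_square)
    moreover have "(\<Phi> has_field_derivative f (dual a c \<theta>)) (at (dual a c \<theta>) within {r..1})"
      unfolding \<Phi>_def r_def using cont dual_in_range[OF c, of \<theta> a] \<theta>
      by (intro integral_has_real_derivative) (auto simp: r_def)
    \<comment> \<open>The chain rule at a boundary point needs the outer derivative relative to the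
      image of the inner map.\<close>
    then have "(\<Phi> has_field_derivative f (dual a c \<theta>)) (at (dual a c \<theta>) within dual a c ` {r..1})"
      by (rule DERIV_subset) (use dual_in_range[OF c] in \<open>auto simp: r_def\<close>)
    ultimately have "(\<Phi> \<circ> dual a c has_field_derivative f (dual a c \<theta>) * - (B / q\<^sup>2)) (at \<theta> within {r..1})"
      by (intro DERIV_image_chain)
    then have "((\<lambda>\<theta>. - \<Phi> (dual a c \<theta>)) has_field_derivative - (f (dual a c \<theta>) * - (B / q\<^sup>2))) (at \<theta> within {r..1})"
      unfolding o_def by (rule DERIV_minus)
    moreover have "weight a c \<theta> * (1 + dual a c \<theta>) / (1 + \<theta>) = B / q\<^sup>2"
      using weight_mult_dual[OF c \<theta>0, of a] \<theta>0 by (simp add: B_def q_def)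
    then have "weight a c \<theta> * (f (dual a c \<theta>) * (1 + dual a c \<theta>)) / (1 + \<theta>) = - (f (dual a c \<theta>) * - (B / q\<^sup>2))"
      by (metis (no_types, opaque_lifting) minus_mult_right minus_minus mult.left_commute times_divide_eq_right)
    ultimately show ?thesis by (simp add: has_real_derivative_iff_has_vector_derivative)
  qed
  then have "((\<lambda>\<theta>. weight a c \<theta> * (f (dual a c \<theta>) * (1 + dual a c \<theta>)) / (1 + \<theta>)) has_integral
      (- \<Phi> (dual a c 1) - - \<Phi> (dual a c r))) {r..1}"
    by (rule fundamental_theorem_of_calculus[OF r(2)])
  moreover have "dual a c r = dual (Suc a) c 1"
    using b2 by (simp add: dual_def r_def divide_simps) (simp add: algebra_simps)
  ultimately show ?thesis by (simp add: \<Phi>_def r_def)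
qed

lemma dual_tendsto:
  assumes "1 \<le> c"
  shows "(\<lambda>a. dual a c \<theta>) \<longlonglongrightarrow> 1 / c"
proof -
  have "(\<lambda>a. 1 / (c + \<theta> / real b ^ a)) \<longlonglongrightarrow> 1 / (real c + 0)"
    using assms real_tendsto_divide_at_top[OF tendsto_const power_tendsto_at_top, of \<theta>]
    by (intro tendsto_divide tendsto_add tendsto_const) auto
  moreover have "1 / (c + \<theta> / real b ^ a) = dual a c \<theta>" for a
    using b2 by (simp add: dual_def divide_simps) (simp add: algebra_simps)
  ultimately show ?thesis by simp
qed

text \<open>Summing over a < n leaves \<open>\<Phi> (dual n c 1) - \<Phi> (dual 0 c 1)\<close> for
  each c. In the limit this is \<open>\<Phi> (1 / c) - \<Phi> (1 / (c + 1))\<close>, which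
  telescopes over c to the integral over all of [1/b, 1]. Uniform convergence of the series
  justifies integrating term by term.\<close>

lemma dual_op_has_integral:
  assumes lip: "D-lipschitz_on {0..1} \<phi>"
  shows "((\<lambda>\<theta>. dual_op \<phi> \<theta> / (1 + \<theta>)) has_integral integral {1 / b..1} (\<lambda>\<theta>. \<phi> \<theta> / (1 + \<theta>))) {1 / b..1}"
proof -
  define r where "r = 1 / real b"
  define f where "f \<theta> = \<phi> \<theta> / (1 + \<theta>)" for \<theta>
  define \<Phi> where "\<Phi> x = integral {r..x} f" for x
  define K where "K = \<bar>\<phi> 0\<bar> + D"
  have r: "0 < r" "r \<le> 1" using b2 by (auto simp: r_def field_simps)
  have K: "\<bar>\<phi> x\<bar> \<le> K" if "0 \<le> x" "x \<le> 1" for x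
    unfolding K_def using lipschitz_on_unit_bounded[OF lip that] .
  have cont_\<phi>: "continuous_on {r..1} \<phi>"
    using lipschitz_on_continuous_on[OF lip] by (rule continuous_on_subset) (use r in auto)
  have cont_f: "continuous_on {r..1} f"
    unfolding f_def using r by (intro continuous_intros cont_\<phi>) auto
  have cont_\<Phi>: "continuous_on {r..1} \<Phi>"
    unfolding \<Phi>_def using cont_f by (intro indefinite_integral_continuous_1 integrable_continuous_real)
  have dual_r: "dual a c \<theta> \<in> {r..1}" if "1 \<le> c" "c < b" "\<theta> \<in> {r..1}" for a c \<theta>
    using dual_in_range[of c \<theta> a] that by (auto simp: r_def)
  define g where "g a \<theta> = (\<Sum>c=1..<b. weight a c \<theta> * \<phi> (dual a c \<theta>)) / (1 + \<theta>)" for a \<theta>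
  have g_int: "(g a has_integral (\<Sum>c=1..<b. \<Phi> (dual (Suc a) c 1) - \<Phi> (dual a c 1))) {r..1}" for a
  proof -
    have "((\<lambda>\<theta>. \<Sum>c=1..<b. weight a c \<theta> * (f (dual a c \<theta>) * (1 + dual a c \<theta>)) / (1 + \<theta>)) has_integral
        (\<Sum>c=1..<b. \<Phi> (dual (Suc a) c 1) - \<Phi> (dual a c 1))) {r..1}"
      unfolding \<Phi>_def r_def using cont_f
      by (intro has_integral_sum weight_dual_has_integral) (auto simp: r_def)
    moreover have "(\<Sum>c=1..<b. weight a c \<theta> * (f (dual a c \<theta>) * (1 + dual a c \<theta>)) / (1 + \<theta>)) = g a \<theta>"
      if "\<theta> \<in> {r..1}" for \<theta>
      unfolding g_def sum_divide_distrib
    proof (intro sum.cong refl)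
      fix c assume "c \<in> {1..<b}"
      then have "0 < 1 + dual a c \<theta>" using dual_r[of c \<theta> a] that r by auto
      then show "weight a c \<theta> * (f (dual a c \<theta>) * (1 + dual a c \<theta>)) / (1 + \<theta>) =
          weight a c \<theta> * \<phi> (dual a c \<theta>) / (1 + \<theta>)"
        by (simp add: f_def)
    qed
    ultimately show ?thesis by (rule has_integral_eq[rotated])
  qed
  have g_cont: "continuous_on {r..1} (g a)" for a
  proof -
    have "continuous_on {r..1} (weight a c)" "continuous_on {r..1} (dual a c)" if "1 \<le> c" "c < b" for c
    proof -
      have "real b ^ a * c + \<theta> \<noteq> 0" "real b ^ a * (real c + 1) + \<theta> \<noteq> 0" if "\<theta> \<in> {r..1}" for \<theta>
        using denom_bounds(2,3)[OF \<open>1 \<le> c\<close> \<open>c < b\<close>, of \<theta> a] that r by auto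
      then show "continuous_on {r..1} (weight a c)" "continuous_on {r..1} (dual a c)"
        unfolding weight_def[abs_def] dual_def[abs_def] by (auto intro!: continuous_intros simp: add.commute)
    qed
    moreover have "1 + \<theta> \<noteq> 0" if "\<theta> \<in> {r..1}" for \<theta>
      using that r by simp
    ultimately show ?thesis unfolding g_def[abs_def]
      using dual_r by (intro continuous_on_divide continuous_on_sum continuous_on_mult
        continuous_on_add continuous_on_const continuous_on_id
        continuous_on_compose2[OF cont_\<phi>]) auto
  qed
  \<comment> \<open>A geometric majorant for the Weierstrass test: the positive term of
    \<open>sum_weight\<close> is at most \<open>(1 + \<theta>) / b^a\<close>, and its numerator
    cancels against the density.\<close>
  have "norm (g a \<theta>) \<le> K * (1 / b) ^ a" if "\<theta> \<in> {r..1}" for a \<theta>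
  proof -
    have \<theta>: "0 \<le> \<theta>" "\<theta> \<le> 1" using that r by auto
    have "\<bar>\<Sum>c=1..<b. weight a c \<theta> * \<phi> (dual a c \<theta>)\<bar> \<le> (\<Sum>c=1..<b. weight a c \<theta> * K)"
      using \<theta> dual_bounds by (intro order_trans[OF sum_abs] sum_mono)
        (auto simp: abs_mult weight_nonneg intro!: mult_left_mono K)
    also have "\<dots> = ((1 + \<theta>) / (real b ^ a + \<theta>) - (1 + \<theta>) / (real b ^ Suc a + \<theta>)) * K"
      by (simp only: sum_distrib_right[symmetric] sum_weight[OF \<theta>(1)])
    also have "\<dots> \<le> (1 + \<theta>) / real b ^ a * K"
    proof (intro mult_right_mono)
      have "(1 + \<theta>) / (real b ^ a + \<theta>) \<le> (1 + \<theta>) / real b ^ a"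
        using \<theta> pow_ge_1[of a] b2 by (intro divide_left_mono mult_pos_pos add_pos_nonneg) auto
      moreover have "0 \<le> (1 + \<theta>) / (real b ^ Suc a + \<theta>)" using \<theta> by simp
      ultimately show "(1 + \<theta>) / (real b ^ a + \<theta>) - (1 + \<theta>) / (real b ^ Suc a + \<theta>) \<le> (1 + \<theta>) / real b ^ a"
        by linarith
      show "0 \<le> K" using K[of 0] by simp
    qed
    finally have "\<bar>\<Sum>c=1..<b. weight a c \<theta> * \<phi> (dual a c \<theta>)\<bar> / (1 + \<theta>) \<le>
        (1 + \<theta>) / real b ^ a * K / (1 + \<theta>)"
      using \<theta> by (intro divide_right_mono) auto
    also have "\<dots> = K * (1 / b) ^ a" using \<theta> by (simp add: power_divide)
    finally show ?thesis unfolding g_def real_norm_def abs_divide using \<theta> by simp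
  qed
  moreover have "summable (\<lambda>a. K * (1 / b) ^ a)"
    using b2 by (intro summable_mult summable_geometric) simp
  ultimately have ulim: "uniform_limit {r..1} (\<lambda>n \<theta>. \<Sum>a<n. g a \<theta>) (\<lambda>\<theta>. \<Sum>a. g a \<theta>) sequentially"
    by (rule Weierstrass_m_test)
  obtain I J where I: "\<And>n. ((\<lambda>\<theta>. \<Sum>a<n. g a \<theta>) has_integral I n) {r..1}"
    and J: "((\<lambda>\<theta>. \<Sum>a. g a \<theta>) has_integral J) {r..1}" "I \<longlonglongrightarrow> J"
    by (rule uniform_limit_integral[OF ulim]) (auto intro!: continuous_on_sum g_cont)
  have "I n = (\<Sum>c=1..<b. \<Phi> (dual n c 1) - \<Phi> (dual 0 c 1))" for n
  proof -
    have "((\<lambda>\<theta>. \<Sum>a<n. g a \<theta>) has_integral (\<Sum>a<n. \<Sum>c=1..<b. \<Phi> (dual (Suc a) c 1) - \<Phi> (dual a c 1))) {r..1}"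
      by (intro has_integral_sum g_int) auto
    then have "I n = (\<Sum>a<n. \<Sum>c=1..<b. \<Phi> (dual (Suc a) c 1) - \<Phi> (dual a c 1))"
      using I has_integral_unique by blast
    also have "\<dots> = (\<Sum>c=1..<b. \<Sum>a<n. \<Phi> (dual (Suc a) c 1) - \<Phi> (dual a c 1))" by (rule sum.swap)
    also have "\<dots> = (\<Sum>c=1..<b. \<Phi> (dual n c 1) - \<Phi> (dual 0 c 1))"
    proof (rule sum.cong[OF refl])
      fix c
      show "(\<Sum>a<n. \<Phi> (dual (Suc a) c 1) - \<Phi> (dual a c 1)) = \<Phi> (dual n c 1) - \<Phi> (dual 0 c 1)"
        by (rule sum_lessThan_telescope[of "\<lambda>a. \<Phi> (dual a c 1)"])
    qed
    finally show ?thesis .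
  qed
  then have I_eq: "I = (\<lambda>n. \<Sum>c=1..<b. \<Phi> (dual n c 1) - \<Phi> (dual 0 c 1))" by blast
  have "I \<longlonglongrightarrow> (\<Sum>c=1..<b. \<Phi> (1 / c) - \<Phi> (dual 0 c 1))"
    unfolding I_eq
  proof (intro tendsto_intros)
    fix c assume c: "c \<in> {1..<b}"
    then have "1 / real c \<in> {r..1}" using b2 by (auto simp: r_def field_simps)
    moreover have "dual n c 1 \<in> {r..1}" for n using dual_r[of c 1 n] c r by simp
    ultimately show "(\<lambda>n. \<Phi> (dual n c 1)) \<longlonglongrightarrow> \<Phi> (1 / c)"
      using c
      by (intro continuous_on_tendsto_compose[OF cont_\<Phi> dual_tendsto] always_eventually) auto
  qed
  then have "J = (\<Sum>c=1..<b. \<Phi> (1 / c) - \<Phi> (dual 0 c 1))"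
    using J(2) by (rule LIMSEQ_unique[rotated])
  also have "\<dots> = - (\<Sum>c=1..<b. \<Phi> (1 / Suc c) - \<Phi> (1 / c))"
    by (simp add: dual_def sum_negf[symmetric] add.commute)
  also have "\<dots> = \<Phi> 1 - \<Phi> r"
    using b2 by (subst sum_Suc_diff') (auto simp: r_def)
  also have "\<Phi> r = 0" by (simp add: \<Phi>_def)
  finally have "J = integral {r..1} f" by (simp add: \<Phi>_def)
  moreover have "(\<Sum>a. g a \<theta>) = dual_op \<phi> \<theta> / (1 + \<theta>)" if "\<theta> \<in> {r..1}" for \<theta>
    unfolding g_def using that r by (intro sums_unique[symmetric] sums_divide dual_op_sums[OF K]) auto
  ultimately show ?thesis
    using has_integral_eq[OF _ J(1)] unfolding r_def f_def by auto
qed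

lemma dual_op_funpow_has_integral:
  assumes "D-lipschitz_on {0..1} \<phi>" "((\<lambda>\<theta>. \<phi> \<theta> / (1 + \<theta>)) has_integral I) {1 / b..1}"
  shows "((\<lambda>\<theta>. (dual_op ^^ n) \<phi> \<theta> / (1 + \<theta>)) has_integral I) {1 / b..1}"
proof (induction n)
  case (Suc n)
  then show ?case
    using dual_op_has_integral[OF dual_op_funpow_lipschitz[OF assms(1), of n]] by (simp add: integral_unique)
qed (use assms in simp)

section \<open>Explicit integrals and the rate of convergence\<close>

lemma has_integral_ln_linear:
  fixes x :: real
  assumes "0 \<le> x"
  shows "((\<lambda>\<theta>. x / (1 + \<theta> * x)) has_integral ln (real b * (1 + x) / (real b + x))) {1 / b..1}"
proof -
  have pos: "0 < 1 + x / b" using assms by (simp add: add_pos_nonneg)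
  have "((\<lambda>\<theta>. x / (1 + \<theta> * x)) has_integral ln (1 + 1 * x) - ln (1 + 1 / b * x)) {1 / b..1}"
  proof (rule fundamental_theorem_of_calculus)
    fix \<theta> assume "\<theta> \<in> {1 / real b..1}"
    then have "0 \<le> \<theta>" using b2 by (auto intro: order_trans[of 0 "1 / real b"])
    then have "0 < 1 + \<theta> * x" using assms by (intro add_pos_nonneg) auto
    then show "((\<lambda>\<theta>. ln (1 + \<theta> * x)) has_vector_derivative x / (1 + \<theta> * x)) (at \<theta> within {1 / real b..1})"
      unfolding has_real_derivative_iff_has_vector_derivative[symmetric]
      by (auto intro!: derivative_eq_intros)
  qed (use b2 in auto)
  also have "ln (1 + 1 * x) - ln (1 + 1 / b * x) = ln ((1 + x) / (1 + x / b))"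
    using assms pos by (subst ln_div) auto
  also have "(1 + x) / (1 + x / b) = b * (1 + x) / (b + x)"
    using b2 assms by (simp add: field_simps)
  finally show ?thesis .
qed

text \<open>On [1/b, 1] the iterate stays within \<open>\<epsilon>\<close> of its value at 0.
  Integrating against the density of total mass \<open>L\<close> keeps \<open>I\<close> within
  \<open>\<epsilon> L\<close> of that value times \<open>L\<close>, since the integral of the
  iterate is still \<open>I\<close>.\<close>

lemma dual_op_funpow_error:
  assumes lip: "D-lipschitz_on {0..1} \<phi>" and I: "((\<lambda>\<theta>. \<phi> \<theta> / (1 + \<theta>)) has_integral I) {1 / b..1}"
  shows "\<bar>(dual_op ^^ n) \<phi> 0 - I / ln (2 * real b / (real b + 1))\<bar> \<le> (11 / 12) ^ n * D"
proof -
  define L where "L = ln (2 * real b / (real b + 1))"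
  define \<psi> where "\<psi> = (dual_op ^^ n) \<phi>"
  define \<epsilon> where "\<epsilon> = (11 / 12) ^ n * D"
  have "1 < 2 * real b / (real b + 1)" using b2 by (simp add: field_simps)
  then have L: "0 < L" unfolding L_def by (rule ln_gt_zero)
  have L_int: "((\<lambda>\<theta>. 1 / (1 + \<theta>)) has_integral L) {1 / b..1}"
    using has_integral_ln_linear[of 1] by (simp add: L_def mult.commute[of 2])
  have diff: "\<bar>\<psi> \<theta> - \<psi> 0\<bar> \<le> \<epsilon>" "0 \<le> \<theta>" if "\<theta> \<in> {1 / b..1}" for \<theta>
  proof -
    show \<theta>: "0 \<le> \<theta>" using that b2 by (auto intro: order_trans[of 0 "1 / real b"])
    have "\<bar>\<psi> \<theta> - \<psi> 0\<bar> \<le> \<epsilon> * \<bar>\<theta>\<bar>"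
      using lipschitz_onD[OF dual_op_funpow_lipschitz[OF lip], of \<theta> 0 n] \<theta> that
      by (simp add: \<psi>_def \<epsilon>_def dist_real_def)
    also have "\<dots> \<le> \<epsilon> * 1"
      using \<theta> that lipschitz_on_nonneg[OF lip] by (intro mult_left_mono) (auto simp: \<epsilon>_def)
    finally show "\<bar>\<psi> \<theta> - \<psi> 0\<bar> \<le> \<epsilon>" by simp
  qed
  have \<psi>_int: "((\<lambda>\<theta>. \<psi> \<theta> / (1 + \<theta>)) has_integral I) {1 / b..1}"
    unfolding \<psi>_def using lip I by (rule dual_op_funpow_has_integral)
  have c_int: "((\<lambda>\<theta>. k / (1 + \<theta>)) has_integral k * L) {1 / b..1}" for k
    using has_integral_mult_right[OF L_int, of k] by simp
  have "I \<le> (\<psi> 0 + \<epsilon>) * L" "(\<psi> 0 - \<epsilon>) * L \<le> I"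
    by (rule has_integral_le[OF \<psi>_int c_int] has_integral_le[OF c_int \<psi>_int];
      use diff in \<open>force intro!: divide_right_mono simp: abs_le_iff\<close>)+
  then show ?thesis using L unfolding L_def[symmetric] \<psi>_def[symmetric] \<epsilon>_def[symmetric]
    by (simp add: abs_le_iff field_simps)
qed

subsection \<open>Distribution of the remainders\<close>

definition branch :: "nat \<Rightarrow> nat \<Rightarrow> real \<Rightarrow> real" where
  "branch a c u = 1 / (real b ^ a * (c + u))"

text \<open>One step of the process in the coordinate t = z - 1, where the next remainder is 1/t.
  Its inverse branches are the maps \<open>branch a c\<close>.\<close>

definition shift :: "real \<Rightarrow> real" where
  "shift t = 1 / t / real b powi clog_exponent b (1 / t) - of_int (clog_coeff b (1 / t))"

definition sublevel :: "nat \<Rightarrow> real \<Rightarrow> real set" where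
  "sublevel n x = {t \<in> {0<..<1} - \<rat>. (shift ^^ n) t < x}"

text \<open>Up to the factor \<open>1 + \<theta>\<close> this is the distribution function of the
  law with parameter \<open>\<theta>\<close>. The probability of a set is thus
  \<open>1 + \<theta>\<close> times the Lebesgue measure of its image under
  \<open>mobius \<theta>\<close>.\<close>

definition mobius :: "real \<Rightarrow> real \<Rightarrow> real" where
  "mobius \<theta> t = t / (1 + \<theta> * t)"

section \<open>Digits and inverse branches\<close>

lemma clog_exponent_eq_iff:
  assumes "0 < y"
  shows "clog_exponent b y = int a \<longleftrightarrow> real b ^ a \<le> y \<and> y < real b ^ Suc a"
proof -
  have "real b powr (real_of_int (int a) + 1) = real b ^ Suc a"
    using b2 powr_realpow[of "real b" "Suc a"] by (simp add: add.commute)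
  then show ?thesis
    using assms b2 floor_log_eq_powr_iff[of y "real b" "int a"]
    by (simp add: clog_exponent_def powr_realpow)
qed

lemma clog_digits:
  fixes u :: real
  assumes "1 \<le> c" "c < b" "0 \<le> u" "u < 1"
  shows "clog_exponent b (real b ^ a * (c + u)) = int a"
    and "clog_coeff b (real b ^ a * (c + u)) = int c"
proof -
  have B: "0 < real b ^ a" using b2 by simp
  have "real b ^ a * 1 \<le> real b ^ a * (c + u)" using assms B by (intro mult_left_mono) auto
  moreover have "real b ^ a * (c + u) < real b ^ a * b" using assms B by (intro mult_strict_left_mono) auto
  ultimately show exponent: "clog_exponent b (real b ^ a * (c + u)) = int a"
    using B by (subst clog_exponent_eq_iff) (auto simp: mult.commute)
  have "\<lfloor>real c + u\<rfloor> = int c" using assms by (simp add: floor_eq_iff)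
  then show "clog_coeff b (real b ^ a * (c + u)) = int c"
    unfolding clog_coeff_def exponent using B by simp
qed

lemma inverse_branch: "1 / branch a c u = real b ^ a * (c + u)"
  by (simp add: branch_def)

lemma shift_branch:
  assumes "1 \<le> c" "c < b" "0 \<le> u" "u < 1"
  shows "shift (branch a c u) = u"
proof -
  have "0 < real b ^ a" using b2 by simp
  then show ?thesis by (simp add: shift_def inverse_branch clog_digits[OF assms])
qed

lemma branch_in_unit:
  assumes "1 \<le> c" "c < b" "u \<in> {0<..<1} - \<rat>"
  shows "branch a c u \<in> {0<..<1} - \<rat>"
proof -
  have B: "1 \<le> real b ^ a" by (rule pow_ge_1)
  have "1 * 1 < real b ^ a * (c + u)" using assms B by (intro mult_le_less_imp_less) auto
  then have "branch a c u \<in> {0<..<1}" by (simp add: branch_def)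
  moreover have "u \<in> \<rat>" if "branch a c u \<in> \<rat>"
  proof -
    have "u = 1 / branch a c u / real b ^ a - c" using b2 by (simp add: inverse_branch)
    also have "\<dots> \<in> \<rat>" using that by (intro Rats_diff Rats_divide Rats_power) auto
    finally show ?thesis .
  qed
  ultimately show ?thesis using assms by auto
qed

lemma ex_branch:
  assumes "t \<in> {0<..<1} - \<rat>"
  obtains a c u where "1 \<le> c" "c < b" "u \<in> {0<..<1} - \<rat>" "t = branch a c u"
proof -
  define y where "y = 1 / t"
  have y: "1 < y" using assms by (simp add: y_def)
  define a where "a = nat (clog_exponent b y)"
  have "0 \<le> clog_exponent b y" unfolding clog_exponent_def using y b2 by simp
  then have "clog_exponent b y = int a" by (simp add: a_def)
  then have a: "real b ^ a \<le> y" "y < real b ^ Suc a" using clog_exponent_eq_iff[of y a] y by auto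
  have B: "0 < real b ^ a" using b2 by simp
  define q where "q = y / real b ^ a"
  have q: "1 \<le> q" "q < b" using a B by (auto simp: q_def field_simps)
  define c where "c = nat \<lfloor>q\<rfloor>"
  define u where "u = frac q"
  have "0 \<le> \<lfloor>q\<rfloor>" using q by simp
  then have q_eq: "q = c + u" by (simp add: c_def u_def frac_def)
  have t: "t = branch a c u"
    using assms B by (simp add: branch_def q_eq[symmetric]) (simp add: q_def y_def)
  have "1 \<le> \<lfloor>q\<rfloor>" "\<lfloor>q\<rfloor> < int b" using q by (auto simp: floor_less_iff)
  then have c: "1 \<le> c" "c < b" unfolding c_def by linarith+
  have "u \<notin> \<rat>"
  proof
    assume "u \<in> \<rat>"
    then have "branch a c u \<in> \<rat>"
      unfolding branch_def by (intro Rats_divide Rats_mult Rats_add Rats_power) auto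
    then show False using t assms by simp
  qed
  \<comment> \<open>Irrationality excludes the boundary value 0, at which the process would
    terminate.\<close>
  moreover from this have "u \<noteq> 0" by auto
  then have "0 < u" "u < 1" using frac_ge_0[of q] frac_lt_1[of q] by (auto simp: u_def)
  ultimately show ?thesis using that c t by auto
qed

text \<open>Decomposition by the first digit pair: \<open>funpow_Suc_right\<close> peels off the
  innermost \<open>shift\<close>, which cancels the branch and leaves n further steps.\<close>

lemma sublevel_Suc: "sublevel (Suc n) x = (\<Union>a. \<Union>c\<in>{1..<b}. branch a c ` sublevel n x)"
proof (intro equalityI subsetI)
  fix t assume t: "t \<in> sublevel (Suc n) x"
  then have "t \<in> {0<..<1} - \<rat>" by (simp add: sublevel_def)
  then obtain a c u where *: "1 \<le> c" "c < b" "u \<in> {0<..<1} - \<rat>" "t = branch a c u"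
    by (rule ex_branch)
  then have "u \<in> sublevel n x"
    using t shift_branch[of c u a] by (simp add: sublevel_def funpow_Suc_right del: funpow.simps)
  with * show "t \<in> (\<Union>a. \<Union>c\<in>{1..<b}. branch a c ` sublevel n x)"
    by (intro UN_I[of a] UN_I[of c]) auto
next
  fix t assume "t \<in> (\<Union>a. \<Union>c\<in>{1..<b}. branch a c ` sublevel n x)"
  then obtain a c u where *: "1 \<le> c" "c < b" "u \<in> sublevel n x" "t = branch a c u" by auto
  then show "t \<in> sublevel (Suc n) x"
    using branch_in_unit[of c u a] shift_branch[of c u a]
    by (simp add: sublevel_def funpow_Suc_right del: funpow.simps)
qed

text \<open>As functions of u, \<open>mobius \<theta> (branch a c u)\<close> and
  \<open>mobius (dual a c \<theta>) u\<close> are fractional linear with the same pole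
  \<open>u = - q / b^a\<close>, hence they differ by an affine map. This is where the formula for
  \<open>dual\<close> comes from.\<close>

lemma mobius_branch:
  fixes a :: nat
  assumes "1 \<le> c" "c < b" "0 \<le> \<theta>" "0 \<le> u"
  defines "q \<equiv> real b ^ a * c + \<theta>"
  shows "mobius \<theta> (branch a c u) = - (real b ^ a / q\<^sup>2) * mobius (dual a c \<theta>) u + 1 / q"
proof -
  define B where "B = real b ^ a"
  have B: "1 \<le> B" unfolding B_def by (rule pow_ge_1)
  have q: "1 \<le> q" unfolding q_def by (rule denom_bounds[OF assms(1-3)])
  have q_eq: "q = B * c + \<theta>" by (simp add: q_def B_def)
  have qu: "0 < q + B * u" using q B assms by (intro add_pos_nonneg) auto
  have "1 * 1 \<le> B * (c + u)" using assms B by (intro mult_mono) auto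
  then have Bcu: "B * (c + u) \<noteq> 0" by auto
  have "B * (c + u) + \<theta> = q + B * u" by (simp add: q_def B_def algebra_simps)
  then have lhs: "mobius \<theta> (branch a c u) = 1 / (q + B * u)"
    unfolding mobius_def branch_def B_def[symmetric] using Bcu qu by (simp add: field_simps)
  have "mobius (dual a c \<theta>) u = q * u / (q + B * u)"
    unfolding mobius_def dual_def B_def[symmetric] q_eq[symmetric] using q qu by (simp add: field_simps)
  then have "- (B / q\<^sup>2) * mobius (dual a c \<theta>) u + 1 / q = - (B * u / (q * (q + B * u))) + 1 / q"
    using q by (simp add: power2_eq_square)
  also have "\<dots> = 1 / (q + B * u)"
    using q qu by (simp add: divide_simps)
  finally show ?thesis unfolding lhs B_def by simp
qed

section \<open>Images under \<open>mobius\<close> and their Lebesgue measure\<close>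

lemma inj_on_mobius: "0 \<le> \<theta> \<Longrightarrow> inj_on (mobius \<theta>) {0<..<1}"
proof (rule inj_onI)
  fix t u assume *: "0 \<le> \<theta>" "t \<in> {0<..<1}" "u \<in> {0<..<1}" "mobius \<theta> t = mobius \<theta> u"
  then have "0 < 1 + \<theta> * t" "0 < 1 + \<theta> * u" by (auto intro!: add_pos_nonneg)
  with * show "t = u" by (simp add: mobius_def field_simps)
qed

lemma mobius_le: "0 \<le> \<theta> \<Longrightarrow> 0 \<le> t \<Longrightarrow> mobius \<theta> t \<in> {0..t}"
  by (auto simp: mobius_def divide_le_eq add_pos_nonneg mult_le_cancel_left1)

lemma mobius_image:
  assumes "0 \<le> \<theta>" "0 < x"
  shows "mobius \<theta> ` {0<..<x} = {0<..<mobius \<theta> x}"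
proof (intro equalityI subsetI)
  fix v assume "v \<in> mobius \<theta> ` {0<..<x}"
  then obtain t where t: "0 < t" "t < x" "v = mobius \<theta> t" by auto
  then have "0 < 1 + \<theta> * t" "0 < 1 + \<theta> * x" using assms by (auto intro!: add_pos_nonneg)
  then show "v \<in> {0<..<mobius \<theta> x}" unfolding t(3) using t by (simp add: mobius_def field_simps)
next
  fix v assume v: "v \<in> {0<..<mobius \<theta> x}"
  have x: "0 < 1 + \<theta> * x" using assms by (auto intro!: add_pos_nonneg)
  then have *: "v * (1 + \<theta> * x) < x" using v by (simp add: mobius_def field_simps)
  then have "(\<theta> * v) * x < 1 * x" using v by (simp add: algebra_simps)
  then have \<theta>v: "0 < 1 - \<theta> * v" using assms by (subst (asm) mult_less_cancel_right_pos) auto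
  have "v = mobius \<theta> (v / (1 - \<theta> * v))" using \<theta>v by (simp add: mobius_def field_simps)
  moreover have "v / (1 - \<theta> * v) \<in> {0<..<x}" using * \<theta>v v by (simp add: field_simps)
  ultimately show "v \<in> mobius \<theta> ` {0<..<x}" by blast
qed

text \<open>The image of the interval (0, x) is an interval of length
  \<open>mobius \<theta> x\<close>; deleting the rationals removes only a countable set from
  it.\<close>

lemma measure_mobius_sublevel_0:
  assumes "0 \<le> \<theta>" "0 < x" "x < 1"
  shows "mobius \<theta> ` sublevel 0 x \<in> sets lebesgue"
    and "measure lebesgue (mobius \<theta> ` sublevel 0 x) = mobius \<theta> x"
proof -
  define I where "I = {0<..<mobius \<theta> x}"
  have sub: "mobius \<theta> ` sublevel 0 x \<subseteq> I"
    unfolding I_def mobius_image[OF assms(1,2), symmetric] by (auto simp: sublevel_def)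
  have "I - mobius \<theta> ` sublevel 0 x \<subseteq> mobius \<theta> ` \<rat>"
    unfolding I_def mobius_image[OF assms(1,2), symmetric] using assms by (auto simp: sublevel_def)
  then have "negligible (I - mobius \<theta> ` sublevel 0 x)"
    unfolding negligible_iff_null_sets
    by (intro null_sets_completionI countable_imp_null_set_lborel countable_subset[OF _ countable_image[OF countable_rat]])
  then have neg: "negligible (I - mobius \<theta> ` sublevel 0 x \<union> (mobius \<theta> ` sublevel 0 x - I))"
    using sub by (simp add: Diff_eq_empty_iff[THEN iffD2])
  have I: "I \<in> lmeasurable" by (simp add: I_def)
  show "mobius \<theta> ` sublevel 0 x \<in> sets lebesgue"
    using sets_negligible_symdiff[OF _ neg] I by (simp add: fmeasurableD)
  have "0 \<le> mobius \<theta> x" using mobius_le[of \<theta> x] assms by simp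
  then show "measure lebesgue (mobius \<theta> ` sublevel 0 x) = mobius \<theta> x"
    using measure_negligible_symdiff[OF I neg] by (simp add: I_def)
qed

text \<open>The image under \<open>mobius \<theta>\<close> of the branch \<open>(a, c)\<close> is an affine copy of the image under
  \<open>mobius (dual a c \<theta>)\<close>, so no change of variables is needed.\<close>

lemma measure_mobius_sublevel:
  assumes "0 \<le> \<theta>" "\<theta> \<le> 1" "0 < x" "x < 1"
  shows "mobius \<theta> ` sublevel n x \<in> sets lebesgue \<and>
    (1 + \<theta>) * measure lebesgue (mobius \<theta> ` sublevel n x) = (dual_op ^^ n) (\<lambda>\<theta>. (1 + \<theta>) * mobius \<theta> x) \<theta>"
  using assms(1,2)
\<comment> \<open>The parameter must vary, since the hypothesis is applied at
  \<open>dual a c \<theta>\<close>.\<close>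
proof (induction n arbitrary: \<theta>)
  case 0
  then show ?case using measure_mobius_sublevel_0 assms by simp
next
  case (Suc n)
  define \<phi> where "\<phi> = (dual_op ^^ n) (\<lambda>\<theta>. (1 + \<theta>) * mobius \<theta> x)"
  define A where "A a c = mobius \<theta> ` branch a c ` sublevel n x" for a c
  have A: "A a c \<in> lmeasurable \<and> (1 + \<theta>) * measure lebesgue (A a c) = weight a c \<theta> * \<phi> (dual a c \<theta>)"
    if c: "1 \<le> c" "c < b" for a c
  proof -
    define B where "B = real b ^ a"
    define q where "q = B * c + \<theta>"
    define M where "M = mobius (dual a c \<theta>) ` sublevel n x"
    have B: "1 \<le> B" unfolding B_def by (rule pow_ge_1)
    have q: "1 \<le> q" unfolding q_def B_def by (rule denom_bounds[OF c Suc.prems(1)])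
    have dual: "0 \<le> dual a c \<theta>" "dual a c \<theta> \<le> 1" using dual_bounds[OF c Suc.prems] by auto
    have M: "M \<in> sets lebesgue" "(1 + dual a c \<theta>) * measure lebesgue M = \<phi> (dual a c \<theta>)"
      using Suc.IH[OF dual] unfolding M_def \<phi>_def by auto
    have A_eq: "A a c = (\<lambda>v. - (B / q\<^sup>2) *\<^sub>R v + 1 / q) ` M"
      unfolding A_def M_def image_image
    proof (rule image_cong[OF refl])
      fix u assume "u \<in> sublevel n x"
      then have "0 \<le> u" by (auto simp: sublevel_def)
      then show "mobius \<theta> (branch a c u) = - (B / q\<^sup>2) *\<^sub>R mobius (dual a c \<theta>) u + 1 / q"
        using mobius_branch[OF c Suc.prems(1)] by (simp add: B_def q_def)
    qed
    have "A a c \<in> sets lebesgue" unfolding A_eq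
      using M(1) by (intro differentiable_image_in_sets_lebesgue) (auto intro!: derivative_intros simp del: real_scaleR_def)
    moreover have "bounded (A a c)"
    proof (rule bounded_subset)
      show "A a c \<subseteq> {0..1}"
      proof
        fix v assume "v \<in> A a c"
        then obtain u where u: "u \<in> sublevel n x" "v = mobius \<theta> (branch a c u)" by (auto simp: A_def)
        then have "branch a c u \<in> {0<..<1}" using branch_in_unit[OF c, of u a] by (auto simp: sublevel_def)
        then show "v \<in> {0..1}" using mobius_le[of \<theta> "branch a c u"] Suc.prems u by auto
      qed
    qed simp
    ultimately have "A a c \<in> lmeasurable" by (rule bounded_set_imp_lmeasurable[rotated])
    moreover have "measure lebesgue (A a c) = B / q\<^sup>2 * measure lebesgue M"
      unfolding A_eq using measure_lebesgue_affine[of "- (B / q\<^sup>2)" "1 / q" M] B by simp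
    \<comment> \<open>Turns the scaling factor \<open>B / q\<^sup>2\<close> together with the
      prefactor \<open>1 + \<theta>\<close> into the weight and the prefactor at the new
      parameter.\<close>
    moreover have "weight a c \<theta> * (1 + dual a c \<theta>) = (1 + \<theta>) * (B / q\<^sup>2)"
      unfolding B_def q_def by (rule weight_mult_dual[OF c Suc.prems(1)])
    ultimately show ?thesis
      unfolding M(2)[symmetric] by (simp add: mult.assoc[symmetric])
  qed
  \<comment> \<open>A common point would, by injectivity of \<open>mobius \<theta>\<close>, come
    from one point of two branches, whose digits would then agree.\<close>
  have disjoint: "A a c \<inter> A a' c' = {}"
    if "1 \<le> c" "c < b" "1 \<le> c'" "c' < b" "(a, c) \<noteq> (a', c')" for a c a' c'
  proof -
    have "(a, c) = (a', c')" if "v \<in> A a c" "v \<in> A a' c'" for v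
    proof -
      obtain u u' where u: "u \<in> sublevel n x" "v = mobius \<theta> (branch a c u)"
        "u' \<in> sublevel n x" "v = mobius \<theta> (branch a' c' u')" using \<open>v \<in> A a c\<close> \<open>v \<in> A a' c'\<close>
        unfolding A_def by blast
      then have unit: "u \<in> {0<..<1} - \<rat>" "u' \<in> {0<..<1} - \<rat>" by (auto simp: sublevel_def)
      have "branch a c u = branch a' c' u'"
        using inj_onD[OF inj_on_mobius[OF Suc.prems(1)]] u(2,4)
          branch_in_unit[OF \<open>1 \<le> c\<close> \<open>c < b\<close> unit(1)] branch_in_unit[OF \<open>1 \<le> c'\<close> \<open>c' < b\<close> unit(2)]
        by (metis Diff_iff)
      then have "real b ^ a * (c + u) = real b ^ a' * (c' + u')"
        using inverse_branch by metis
      then show ?thesis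
        using clog_digits[of c u a] clog_digits[of c' u' a'] that unit
          \<open>1 \<le> c\<close> \<open>c < b\<close> \<open>1 \<le> c'\<close> \<open>c' < b\<close> by simp
    qed
    then show ?thesis using that by blast
  qed
  define G where "G a = (\<Union>c\<in>{1..<b}. A a c)" for a
  have G: "mobius \<theta> ` sublevel (Suc n) x = (\<Union>a. G a)"
    unfolding sublevel_Suc G_def A_def by (simp add: image_UN)
  have G_sets: "G a \<in> sets lebesgue" for a
    unfolding G_def using A by (intro sets.finite_UN) (auto simp: fmeasurableD)
  have G_measure: "(1 + \<theta>) * measure lebesgue (G a) = (\<Sum>c=1..<b. weight a c \<theta> * \<phi> (dual a c \<theta>))" for a
  proof -
    have "measure lebesgue (G a) = (\<Sum>c=1..<b. measure lebesgue (A a c))"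
      unfolding G_def using A disjoint by (intro measure_UNION') (auto simp: pairwise_def disjnt_def)
    then show ?thesis using A by (simp add: sum_distrib_left)
  qed
  have "(\<Union>a. G a) \<subseteq> {0..1}"
    unfolding G[symmetric]
  proof
    fix v assume "v \<in> mobius \<theta> ` sublevel (Suc n) x"
    then obtain u where "u \<in> {0<..<1}" "v = mobius \<theta> u" by (auto simp: sublevel_def)
    then show "v \<in> {0..1}" using mobius_le[of \<theta> u] Suc.prems by auto
  qed
  then have "bounded (\<Union>a. G a)" by (rule bounded_subset[rotated]) simp
  then have "(\<Union>a. G a) \<in> lmeasurable" using G_sets by (intro bounded_set_imp_lmeasurable) auto
  \<comment> \<open>Countable additivity of the real-valued \<open>measure\<close> requires the
    union to have finite measure.\<close>
  then have "emeasure lebesgue (\<Union>a. G a) \<noteq> \<infinity>" by (auto simp: fmeasurable_def)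
  moreover have "disjoint_family G"
    unfolding disjoint_family_on_def
  proof (intro ballI impI)
    fix a a' :: nat assume "a \<noteq> a'"
    then have "A a c \<inter> A a' c' = {}" if "c \<in> {1..<b}" "c' \<in> {1..<b}" for c c'
      using disjoint[of c c' a a'] that by simp
    then show "G a \<inter> G a' = {}" unfolding G_def by blast
  qed
  ultimately have "(\<lambda>a. measure lebesgue (G a)) sums measure lebesgue (\<Union>a. G a)"
    using G_sets by (intro measure_UNION) auto
  then have "(\<lambda>a. \<Sum>c=1..<b. weight a c \<theta> * \<phi> (dual a c \<theta>)) sums ((1 + \<theta>) * measure lebesgue (\<Union>a. G a))"
    unfolding G_measure[symmetric] by (rule sums_mult)
  then have "(1 + \<theta>) * measure lebesgue (\<Union>a. G a) = dual_op \<phi> \<theta>"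
    unfolding dual_op_def by (rule sums_unique)
  then show ?case using G G_sets by (simp add: \<phi>_def sets.countable_UN)
qed

section \<open>From the map \<open>shift\<close> back to the remainders of the process\<close>

lemma clog_y_Suc:
  assumes "t \<in> {0<..<1}"
  shows "clog_y b (1 + t) (Suc n) = 1 / (shift ^^ n) t"
proof (induction n)
  case 0
  \<comment> \<open>The first step has digits a = 0 and c = 1 and turns 1 + t into 1/t; this
    accounts for the index shift between \<open>clog_y\<close> and the iterates of
    \<open>shift\<close>.\<close>
  have "clog_exponent b (1 + t) = 0" "clog_coeff b (1 + t) = 1"
    using clog_digits[of 1 t 0] b2 assms by auto
  then show ?case by simp
next
  case (Suc n)
  have "real b powi k / (y - c * real b powi k) = 1 / (y / real b powi k - c)" for k :: int and y c :: real
  proof -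
    have "real b powi k \<noteq> 0" using b2 by simp
    have "y - c * P = P * (y / P - c)" if "P \<noteq> 0" for P :: real
      using that by (simp add: right_diff_distrib)
    with \<open>real b powi k \<noteq> 0\<close> show ?thesis by simp
  qed
  then have "clog_y b (1 + t) (Suc (Suc n)) = 1 / shift ((shift ^^ n) t)"
    unfolding clog_y.simps(2)[of b "1 + t" "Suc n"] Suc.IH shift_def by simp
  then show ?case by simp
qed

lemma clog_z_eq:
  assumes "t \<in> {0<..<1}"
  shows "clog_z b n (1 + t) = 1 + (shift ^^ n) t"
proof (cases n)
  case 0
  have "clog_exponent b (1 + t) = 0" "clog_coeff b (1 + t) = 1"
    using clog_digits[of 1 t 0] b2 assms by auto
  then show ?thesis using 0 by (simp add: clog_z_def clog_a_def clog_c_def)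
next
  case (Suc m)
  then show ?thesis
    unfolding clog_z_def clog_a_def clog_c_def Suc clog_y_Suc[OF assms] by (simp add: shift_def)
qed

lemma clog_M_eq: "clog_M b n x = (+) 1 ` sublevel n (x - 1)"
proof (intro equalityI subsetI)
  fix \<alpha> assume \<alpha>: "\<alpha> \<in> clog_M b n x"
  then have "\<alpha> - 1 \<in> {0<..<1}" "\<alpha> - 1 \<notin> \<rat>"
    using Rats_add[of "\<alpha> - 1" 1] by (auto simp: clog_M_def)
  then have "\<alpha> - 1 \<in> sublevel n (x - 1)"
    using \<alpha> clog_z_eq[of "\<alpha> - 1" n] by (auto simp: clog_M_def sublevel_def)
  then show "\<alpha> \<in> (+) 1 ` sublevel n (x - 1)" by (intro image_eqI[of _ _ "\<alpha> - 1"]) auto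
next
  fix \<alpha> assume "\<alpha> \<in> (+) 1 ` sublevel n (x - 1)"
  then obtain t where t: "t \<in> sublevel n (x - 1)" "\<alpha> = 1 + t" by auto
  then have "1 + t \<notin> \<rat>" using Rats_diff[of "1 + t" 1] by (auto simp: sublevel_def)
  then show "\<alpha> \<in> clog_M b n x"
    using t clog_z_eq[of t n] by (auto simp: clog_M_def sublevel_def)
qed

text \<open>Lebesgue measure is the law with parameter 0: there \<open>mobius\<close> is the
  identity and the prefactor is 1.\<close>

lemma clog_m_eq:
  assumes "1 < x" "x < 2"
  shows "clog_m b n x = (dual_op ^^ n) (\<lambda>\<theta>. (1 + \<theta>) * mobius \<theta> (x - 1)) 0"
proof -
  have "mobius 0 ` sublevel n (x - 1) = sublevel n (x - 1)" by (simp add: mobius_def)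
  then show ?thesis
    using measure_mobius_sublevel[of 0 "x - 1" n] assms
    by (simp add: clog_m_def clog_M_eq measure_translation)
qed

text \<open>The difference quotient is exactly \<open>x (1 - x) / ((1 + s x) (1 + t x))\<close>,
  which lies between 0 and 1.\<close>

lemma mobius_lipschitz:
  assumes "0 \<le> x" "x \<le> 1"
  shows "1-lipschitz_on {0..1} (\<lambda>\<theta>. (1 + \<theta>) * mobius \<theta> x)"
proof (rule lipschitz_onI)
  fix s t :: real assume "s \<in> {0..1}" "t \<in> {0..1}"
  then have pos: "1 \<le> 1 + s * x" "1 \<le> 1 + t * x" using assms by auto
  have "(1 + s) * mobius s x - (1 + t) * mobius t x = (s - t) * (x * (1 - x) / ((1 + s * x) * (1 + t * x)))"
  proof -
    have "(1 + s) * x * (1 + t * x) - (1 + t) * x * (1 + s * x) = (s - t) * (x * (1 - x))"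
      by (simp add: algebra_simps)
    then show ?thesis using pos by (simp add: mobius_def diff_frac_eq)
  qed
  moreover have "x * (1 - x) / ((1 + s * x) * (1 + t * x)) \<le> 1 * 1 / (1 * 1)"
    using pos assms by (intro frac_le mult_mono) auto
  moreover have "0 \<le> x * (1 - x) / ((1 + s * x) * (1 + t * x))" using pos assms by auto
  ultimately show "dist ((1 + s) * mobius s x) ((1 + t) * mobius t x) \<le> 1 * dist s t"
    by (simp only: dist_real_def abs_mult abs_of_nonneg mult_1) (simp only: mult_1_right mult_left_le abs_ge_zero)
qed simp

lemma clog_m_error:
  assumes "1 < x" "x < 2"
  shows "\<bar>clog_m b n x - ln (real b * x / (x + real b - 1)) / ln (2 * real b / (real b + 1))\<bar> \<le> (11 / 12) ^ n"
proof -
  define \<phi> where "\<phi> \<theta> = (1 + \<theta>) * mobius \<theta> (x - 1)" for \<theta>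
  \<comment> \<open>Division by \<open>1 + \<theta>\<close> cancels the prefactor of
    \<open>\<phi>\<close>, so the logarithmic integral at \<open>x - 1\<close> gives the numerator
    of the limit law; the same formula at 1 gave the normaliser.\<close>
  have "((\<lambda>\<theta>. (x - 1) / (1 + \<theta> * (x - 1))) has_integral ln (real b * x / (x + real b - 1))) {1 / b..1}"
    using has_integral_ln_linear[of "x - 1"] assms by (simp add: algebra_simps)
  then have "((\<lambda>\<theta>. \<phi> \<theta> / (1 + \<theta>)) has_integral ln (real b * x / (x + real b - 1))) {1 / b..1}"
  proof (rule has_integral_eq[rotated])
    fix \<theta> assume "\<theta> \<in> {1 / real b..1}"
    moreover have "0 < 1 / real b" using b2 by simp
    ultimately have "1 + \<theta> \<noteq> 0" unfolding atLeastAtMost_iff by linarith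
    then show "(x - 1) / (1 + \<theta> * (x - 1)) = \<phi> \<theta> / (1 + \<theta>)" by (simp add: \<phi>_def mobius_def)
  qed
  moreover have "1-lipschitz_on {0..1} \<phi>"
    unfolding \<phi>_def[abs_def] using assms by (intro mobius_lipschitz) auto
  ultimately have "\<bar>(dual_op ^^ n) \<phi> 0 - ln (real b * x / (x + real b - 1)) / ln (2 * real b / (real b + 1))\<bar> \<le> (11 / 12) ^ n * 1"
    by (intro dual_op_funpow_error)
  then show ?thesis using clog_m_eq[OF assms, of n] by (simp add: \<phi>_def[abs_def])
qed

end

theorem theorem17:
  fixes b :: nat
  assumes "b \<ge> 2"
  shows "\<exists>A>0. \<exists>l>0. \<forall>n::nat. \<forall>x\<in>{1<..<2::real}.
           \<bar>clog_m b n x - ln (real b * x / (x + real b - 1)) / ln (2 * real b / (real b + 1))\<bar>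
             < A * exp (- l * sqrt (real n))"
proof -
  interpret clog_base b using assms by unfold_locales
  \<comment> \<open>Chosen so that \<open>(11/12)^n\<close> equals \<open>exp (- l * n)\<close>;
    replacing n by its square root only weakens the bound.\<close>
  define l where "l = ln (12 / 11 :: real)"
  have l: "0 < l" by (simp add: l_def)
  have "\<bar>clog_m b n x - ln (real b * x / (x + real b - 1)) / ln (2 * real b / (real b + 1))\<bar>
      < 2 * exp (- l * sqrt (real n))" if "x \<in> {1<..<2}" for n :: nat and x :: real
  proof -
    have "real n \<le> (real n)\<^sup>2"
      unfolding power2_eq_square of_nat_mult[symmetric] of_nat_le_iff by (rule le_square)
    then have "sqrt n \<le> n" by (intro real_le_lsqrt) auto
    have "\<bar>clog_m b n x - ln (real b * x / (x + real b - 1)) / ln (2 * real b / (real b + 1))\<bar>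
        \<le> (11 / 12) ^ n"
      using clog_m_error[of x n] that by simp
    also have "(11 / 12 :: real) ^ n = exp (- l * n)"
      using exp_of_nat2_mult[of "- l" n] by (simp add: l_def exp_minus)
    also have "\<dots> \<le> exp (- l * sqrt n)" using l \<open>sqrt n \<le> n\<close> by simp
    \<comment> \<open>The factor 2 makes the inequality strict.\<close>
    also have "\<dots> < 2 * exp (- l * sqrt n)" by simp
    finally show ?thesis .
  qed
  then show ?thesis using l by (intro exI[of _ 2] exI[of _ l] conjI allI ballI) auto
qed

end
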